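(* Let $\alpha,\beta\ge 0$, and let $\varphi(z)=1+B_1z+B_2z^2+\cdots$ and $\psi(z)=1+D_1z+D_2z^2+\cdots$ be analytic functions on $\mathbb{D}$ with $B_1>0$, $D_1>0$ and $B_2,D_2\in\mathbb{R}$. Let $f(z)=z+\sum_{n=2}^{\infty}a_nz^n$ be bi-univalent in $\mathbb{D}$ and let $g=f^{-1}$. If $f\in\mathcal{M}(\alpha,\varphi)$ and $g\in\mathcal{M}(\beta,\psi)$, then, with $\sigma:=2+3\alpha+3\beta+4\alpha\beta$, $$|a_2|\le \frac{B_1D_1\sqrt{B_1(1+2\beta)+D_1(1+2\alpha)}}{\sqrt{\left|\sigma B_1^2D_1^2-(1+\alpha)^2(1+2\beta)(B_2-B_1)D_1^2-(1+\beta)^2(1+2\alpha)(D_2-D_1)B_1^2\right|}}$$ (provided the denominator is nonzero), and $$2\sigma|a_3|\le B_1(3+5\beta)+D_1(1+3\alpha)+(3+5\beta)|B_2-B_1|+\frac{(1+\beta)^2(1+3\alpha)B_1^2|D_2-D_1|}{D_1^2(1+\alpha)^2}.$$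
   Context: $\mathbb{D}=\{z\in\mathbb{C}:|z|<1\}$. $\mathcal{S}$ is the class of univalent (injective) analytic functions $f$ on $\mathbb{D}$ with $f(0)=0$, $f'(0)=1$. By the Koebe one-quarter theorem each $f\in\mathcal{S}$ has an inverse $f^{-1}$ defined at least on $|w|<1/4$. A function $f\in\mathcal{S}$ is bi-univalent in $\mathbb{D}$ if both $f$ and $f^{-1}$ are univalent in $\mathbb{D}$, i.e. the local inverse $f^{-1}$ at $0$ extends to a univalent analytic function on $\mathbb{D}$, still denoted $f^{-1}$. Subordination: for analytic $F,G$ on $\mathbb{D}$, $F(z)\prec G(z)$ means there is an analytic $w:\mathbb{D}\to\mathbb{D}$ with $w(0)=0$ and $F(z)=G(w(z))$ on $\mathbb{D}$. For $\alpha\ge0$ and analytic $\varphi:\mathbb{D}\to\mathbb{C}$, $\varphi(z)=1+B_1z+B_2z^2+\cdots$ with $B_1>0$, $B_2\in\mathbb{R}$, $$\mathcal{M}(\alpha,\varphi):=\left\{f\in\mathcal{S}:\ (1-\alpha)\frac{zf'(z)}{f(z)}+\alpha\left(1+\frac{zf''(z)}{f'(z)}\right)\prec\varphi(z)\right\}$$ (quotients are given their limiting values at $z=0$). No univalence or positivity of the real part of $\varphi,\psi$ is assumed. *)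

theory Defs
  imports "HOL-Complex_Analysis.Complex_Analysis"
begin

abbreviation unit_disc :: "complex set" ("\<D>") where
  "\<D> \<equiv> ball 0 1"

text \<open>Functions on the disc are total functions \<open>complex \<Rightarrow> complex\<close>; only their values on the
  disc enter the definitions below.\<close>

abbreviation taylor_coeff :: "(complex \<Rightarrow> complex) \<Rightarrow> nat \<Rightarrow> complex" where
  "taylor_coeff f n \<equiv> fps_nth (fps_expansion f 0) n"

definition univalent :: "(complex \<Rightarrow> complex) \<Rightarrow> bool" where
  "univalent f \<longleftrightarrow> f holomorphic_on \<D> \<and> inj_on f \<D>"

definition class_S :: "(complex \<Rightarrow> complex) set" where
  "class_S = {f. univalent f \<and> f 0 = 0 \<and> deriv f 0 = 1}"

text \<open>For \<open>f \<in> class_S\<close> the image of the disc is an open neighbourhood of \<open>0\<close>, so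
  \<open>inv_into \<D> f\<close> is a genuine inverse near \<open>0\<close>. By the identity theorem the extension \<open>g\<close> is
  uniquely determined on the disc.\<close>

definition univalent_inverse :: "(complex \<Rightarrow> complex) \<Rightarrow> (complex \<Rightarrow> complex) \<Rightarrow> bool" where
  "univalent_inverse f g \<longleftrightarrow>
     univalent g \<and> (\<forall>\<^sub>F w in nhds 0. g w = inv_into \<D> f w)"

definition bi_univalent :: "(complex \<Rightarrow> complex) \<Rightarrow> bool" where
  "bi_univalent f \<longleftrightarrow> f \<in> class_S \<and> (\<exists>g. univalent_inverse f g)"

definition subordinate :: "(complex \<Rightarrow> complex) \<Rightarrow> (complex \<Rightarrow> complex) \<Rightarrow> bool"
    (infix "\<prec>\<^sub>s" 50) where
  "F \<prec>\<^sub>s G \<longleftrightarrow>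
     (\<exists>w. w holomorphic_on \<D> \<and> w ` \<D> \<subseteq> \<D> \<and> w 0 = 0 \<and> (\<forall>z\<in>\<D>. F z = G (w z)))"

text \<open>The value at \<open>0\<close> is the limit of \<open>z f'(z) / f(z)\<close>, see \<open>tendsto_log_deriv\<close> below.\<close>

definition log_deriv :: "(complex \<Rightarrow> complex) \<Rightarrow> complex \<Rightarrow> complex" where
  "log_deriv f z = (if z = 0 then 1 else z * deriv f z / f z)"

definition class_M :: "real \<Rightarrow> (complex \<Rightarrow> complex) \<Rightarrow> (complex \<Rightarrow> complex) set" where
  "class_M \<alpha> \<phi> = {f \<in> class_S.
     (\<lambda>z. (1 - of_real \<alpha>) * log_deriv f z
          + of_real \<alpha> * (1 + z * deriv (deriv f) z / deriv f z)) \<prec>\<^sub>s \<phi>}"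

lemma tendsto_log_deriv:
  assumes "f \<in> class_S"
  shows "((\<lambda>z. z * deriv f z / f z) \<longlongrightarrow> log_deriv f 0) (at 0)"
proof -
  have hol: "f holomorphic_on \<D>" and f0: "f 0 = 0" and d0: "deriv f 0 = 1"
    using assms by (auto simp: class_S_def univalent_def)
  have "(f has_field_derivative 1) (at 0)"
    using holomorphic_derivI[OF hol, of 0] d0 by simp
  then have q: "((\<lambda>z. f z / z) \<longlongrightarrow> 1) (at 0)"
    by (simp add: has_field_derivative_iff f0)
  have "isCont (deriv f) 0"
    using holomorphic_deriv[OF hol] 
    by (intro continuous_on_interior[of \<D>] holomorphic_on_imp_continuous_on) auto
  then have "(deriv f \<longlongrightarrow> 1) (at 0)"
    by (simp add: isCont_def d0)
  from tendsto_divide[OF this q] 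
  have "((\<lambda>z. deriv f z / (f z / z)) \<longlongrightarrow> 1) (at 0)"
    by simp
  then show ?thesis
    by (simp add: log_deriv_def mult.commute)
qed

end

theory Submission
  imports Defs
begin

unbundle no vec_syntax

text \<open>Comparing Taylor coefficients in the two subordinations, with Schwarz functions
  \<open>c\<^sub>1 z + c\<^sub>2 z\<^sup>2 + \<dots>\<close> and \<open>d\<^sub>1 z + d\<^sub>2 z\<^sup>2 + \<dots>\<close>, expresses \<open>a\<^sub>2\<close> in \<open>c\<^sub>1\<close> and in \<open>d\<^sub>1\<close>, and
  gives two linear equations in \<open>a\<^sub>2\<^sup>2\<close> and \<open>a\<^sub>3\<close>, because \<open>g(w) = w - a\<^sub>2 w\<^sup>2 + (2 a\<^sub>2\<^sup>2 - a\<^sub>3) w\<^sup>3 + \<dots>\<close>.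
  Eliminating \<open>a\<^sub>3\<close> bounds \<open>a\<^sub>2\<close>, eliminating \<open>a\<^sub>2\<^sup>2\<close> bounds \<open>a\<^sub>3\<close>; the only analytic input is
  \<open>\<bar>c\<^sub>2 + c\<^sub>1\<^sup>2\<bar> \<le> 1\<close>, which follows from the Schwarz-Pick inequality \<open>\<bar>c\<^sub>2\<bar> \<le> 1 - \<bar>c\<^sub>1\<bar>\<^sup>2\<close>.\<close>

section \<open>Power series expansions at the origin\<close>

lemma eventually_in_disc: "\<forall>\<^sub>F z in nhds 0. z \<in> \<D>"
  by (intro eventually_nhds_in_open) auto

lemma holomorphic_on_disc_has_fps_expansion:
  assumes "f holomorphic_on \<D>"
  shows "f has_fps_expansion fps_expansion f 0"
  using assms by (intro has_fps_expansion_fps_expansion[of \<D>]) auto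

text \<open>The expansion depends only on the germ at 0, so an equation between functions near 0
  turns into an identity of formal power series whose coefficients can be compared.\<close>

lemma has_fps_expansion_eventually_eq:
  fixes F G :: "complex fps"
  assumes "f has_fps_expansion F" and "g has_fps_expansion G" and "\<forall>\<^sub>F z in nhds 0. f z = g z"
  shows "F = G"
  using has_fps_expansion_cong[OF assms(3) refl, of F] assms(1,2) fps_expansion_unique_complex
  by blast

section \<open>The first two coefficients of a Schwarz function\<close>

text \<open>A disc automorphism \<open>M\<close> moves \<open>h 0\<close> to 0, so the Schwarz lemma
  bounds the derivative of \<open>M \<circ> h\<close> at 0 by 1; the chain rule then gives the
  factor 1 - |h(0)|^2.\<close>

lemma norm_deriv_0_le_Schwarz_Pick:
  assumes h: "h holomorphic_on \<D>" and lt: "\<And>z. norm z < 1 \<Longrightarrow> norm (h z) < 1"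
  shows "norm (deriv h 0) \<le> 1 - (norm (h 0))\<^sup>2"
proof -
  define c where "c = h 0"
  define M where "M = Moebius_function 0 c"
  have c: "norm c < 1"
    using lt[of 0] by (simp add: c_def)
  then have c2: "(norm c)\<^sup>2 < 1"
    by (simp add: abs_square_less_1)
  have cc: "cnj c * c = of_real ((norm c)\<^sup>2)"
    by (metis complex_norm_square mult.commute)
  then have nz: "1 - cnj c * c \<noteq> 0"
    using c2 by (metis less_irrefl of_real_1 of_real_eq_iff right_minus_eq)
  have M_hol: "M holomorphic_on \<D>"
    unfolding M_def by (rule Moebius_function_holomorphic[OF c])
  have comp_hol: "(M \<circ> h) holomorphic_on \<D>"
    using h M_hol lt by (intro holomorphic_on_compose_gen[where t = \<D>]) auto
  \<comment> \<open>The numerator of \<open>M\<close> vanishes at \<open>c\<close>, so the quotient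
    rule leaves only the reciprocal of the denominator.\<close>
  have M': "(M has_field_derivative 1 / (1 - cnj c * c)) (at c)"
    unfolding M_def Moebius_function_def using nz
    by (auto intro!: derivative_eq_intros)
  have "(h has_field_derivative deriv h 0) (at 0)"
    using holomorphic_derivI[OF h, of 0] by simp
  with M' have "((M \<circ> h) has_field_derivative (1 / (1 - cnj c * c)) * deriv h 0) (at 0)"
    unfolding c_def by (intro DERIV_chain) auto
  then have d: "deriv (M \<circ> h) 0 = deriv h 0 / (1 - cnj c * c)"
    by (simp add: DERIV_imp_deriv)
  have "norm (deriv (M \<circ> h) 0) \<le> 1"
  proof (rule Schwarz_Lemma(2)[OF comp_hol, of 0])
    show "(M \<circ> h) 0 = 0"
      by (simp add: M_def c_def Moebius_function_eq_zero)
    show "norm ((M \<circ> h) z) < 1" if "norm z < 1" for z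
      using that Moebius_function_norm_lt_1[OF c lt] by (simp add: M_def)
  qed simp
  moreover have "norm (1 - cnj c * c) = 1 - (norm c)\<^sup>2"
  proof -
    have "1 - cnj c * c = of_real (1 - (norm c)\<^sup>2)"
      by (simp add: cc)
    then show ?thesis
      using c2 by (simp only: norm_of_real)
  qed
  ultimately show ?thesis
    using c2 by (simp add: d norm_divide divide_le_eq flip: c_def)
qed

text \<open>Writing w(z) = z h(z) shifts the coefficients: those of z and z^2 in \<open>w\<close>
  are h(0) and h'(0). The Schwarz-Pick bound |h'(0)| \<le> 1 - |h(0)|^2 leaves exactly enough room
  to add the square of the first coefficient.\<close>

lemma Schwarz_function_coeffs:
  assumes w: "w holomorphic_on \<D>" "w ` \<D> \<subseteq> \<D>" and w0: "w 0 = 0"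
  shows "norm (taylor_coeff w 1) \<le> 1"
    and "norm (taylor_coeff w 2 + (taylor_coeff w 1)\<^sup>2) \<le> 1"
proof -
  obtain h where h: "h holomorphic_on \<D>" and wh: "\<And>z. norm z < 1 \<Longrightarrow> w z = z * h z"
    and dw: "deriv w 0 = h 0"
    using Schwarz3[OF w(1) w0] by metis
  have lt: "norm (w z) < 1" if "norm z < 1" for z
    using w(2) that by (simp add: image_subset_iff)
  have coeff1: "taylor_coeff w 1 = h 0"
    using dw by (simp add: fps_expansion_def)
  have "(\<lambda>z. z * h z) has_fps_expansion fps_X * fps_expansion h 0"
    by (intro fps_expansion_intros holomorphic_on_disc_has_fps_expansion h)
  moreover have "\<forall>\<^sub>F z in nhds 0. w z = z * h z"
    using eventually_in_disc by eventually_elim (auto simp: wh)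
  ultimately have "fps_expansion w 0 = fps_X * fps_expansion h 0"
    using has_fps_expansion_eventually_eq holomorphic_on_disc_has_fps_expansion[OF w(1)] by blast
  then have coeff2: "taylor_coeff w 2 = deriv h 0"
    by (simp add: fps_expansion_def)
  show le1: "norm (taylor_coeff w 1) \<le> 1"
    using Schwarz_Lemma(2)[OF w(1) w0 lt, of 0] dw coeff1 by simp
  have "norm (deriv h 0) \<le> 1 - (norm (h 0))\<^sup>2"
  \<comment> \<open>The Schwarz lemma gives only |h| \<le> 1, whereas the Schwarz-Pick lemma above
    asks for strict inequality. If |h| reaches 1 inside the disc, the equality case of the Schwarz
    lemma makes \<open>w\<close> a rotation, and both sides of the bound are 0.\<close>
  proof (cases "\<exists>z. norm z < 1 \<and> norm (h z) \<ge> 1")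
    case False
    then show ?thesis
      using norm_deriv_0_le_Schwarz_Pick[OF h] by (meson not_le)
  next
    case True
    then obtain z where z: "norm z < 1" "norm (h z) \<ge> 1" by blast
    have "(\<exists>z. norm z < 1 \<and> z \<noteq> 0 \<and> norm (w z) = norm z) \<or> norm (deriv w 0) = 1"
    proof (cases "z = 0")
      case True
      then show ?thesis
        using z le1 dw coeff1 by auto
    next
      case False
      have "norm (w z) \<le> norm z"
        using Schwarz_Lemma(1)[OF w(1) w0 lt z(1)] .
      moreover have "norm (w z) \<ge> norm z"
        using z wh by (simp add: norm_mult mult_le_cancel_left1)
      ultimately show ?thesis
        using False z by force
    qed
    then obtain a where a: "\<And>z. norm z < 1 \<Longrightarrow> w z = a * z" "norm a = 1"
      using Schwarz_Lemma(3)[OF w(1) w0 lt, of 0] by auto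
    have "\<forall>\<^sub>F z in nhds 0. w z = a * z"
      using eventually_in_disc by eventually_elim (auto simp: a)
    moreover have "(\<lambda>z. a * z) has_fps_expansion fps_const a * fps_X"
      by (intro fps_expansion_intros)
    ultimately have "fps_expansion w 0 = fps_const a * fps_X"
      using has_fps_expansion_eventually_eq holomorphic_on_disc_has_fps_expansion[OF w(1)] by blast
    then have "h 0 = a" "deriv h 0 = 0"
      using coeff1 coeff2 by (simp_all add: fps_X_def)
    then show ?thesis
      using a by simp
  qed
  moreover have "norm (deriv h 0 + (h 0)\<^sup>2) \<le> norm (deriv h 0) + (norm (h 0))\<^sup>2"
    by (metis norm_power norm_triangle_ineq)
  ultimately show "norm (taylor_coeff w 2 + (taylor_coeff w 1)\<^sup>2) \<le> 1"
    using coeff1 coeff2 by simp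
qed

section \<open>Coefficient equations from subordination and inversion\<close>

lemma class_S_taylor_coeff:
  assumes "f \<in> class_S"
  shows "f has_fps_expansion fps_expansion f 0" and "taylor_coeff f 0 = 0" and "taylor_coeff f 1 = 1"
  using assms holomorphic_on_disc_has_fps_expansion[of f]
  by (auto simp: class_S_def univalent_def fps_expansion_def)

text \<open>For the Schwarz function w = w_1 z + w_2 z^2 + ..., the witnesses are c = w_1 and p =
  w_2 + w_1^2. Splitting B_1 w_2 + B_2 w_1^2 as B_1 p + (B_2 - B_1) c^2 produces the differences of
  coefficients that appear in the final bounds.\<close>

lemma class_M_coeffs:
  assumes f: "f \<in> class_M \<alpha> \<phi>" and \<phi>: "\<phi> holomorphic_on \<D>" "\<phi> 0 = 1"
  obtains c p where "norm c \<le> 1" and "norm p \<le> 1"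
    and "(1 + of_real \<alpha>) * taylor_coeff f 2 = taylor_coeff \<phi> 1 * c"
    and "2 * (1 + 2 * of_real \<alpha>) * taylor_coeff f 3 - (1 + 3 * of_real \<alpha>) * (taylor_coeff f 2)\<^sup>2
         = taylor_coeff \<phi> 1 * p + (taylor_coeff \<phi> 2 - taylor_coeff \<phi> 1) * c\<^sup>2"
proof -
  define a where "a = complex_of_real \<alpha>"
  have S: "f \<in> class_S" and hol: "f holomorphic_on \<D>" and inj: "inj_on f \<D>" and f0: "f 0 = 0"
    using f by (auto simp: class_M_def class_S_def univalent_def)
  obtain w where w: "w holomorphic_on \<D>" "w ` \<D> \<subseteq> \<D>" "w 0 = 0"
    and eq: "\<And>z. z \<in> \<D> \<Longrightarrow> (1 - a) * log_deriv f z + a * (1 + z * deriv (deriv f) z / deriv f z) = \<phi> (w z)"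
    using f by (auto simp: class_M_def subordinate_def a_def)
  define F where "F = fps_expansion f 0"
  define W where "W = fps_expansion w 0"
  define P where "P = fps_expansion \<phi> 0"
  have F: "f has_fps_expansion F" and [simp]: "F $ 0 = 0" "F $ Suc 0 = 1"
    using class_S_taylor_coeff[OF S] by (simp_all add: F_def)
  have W: "w has_fps_expansion W" and [simp]: "W $ 0 = 0"
    using holomorphic_on_disc_has_fps_expansion[OF w(1)] w(3) by (simp_all add: W_def fps_expansion_def)
  have P: "\<phi> has_fps_expansion P" and [simp]: "P $ 0 = 1"
    using holomorphic_on_disc_has_fps_expansion[OF \<phi>(1)] \<phi>(2) by (simp_all add: P_def fps_expansion_def)
  \<comment> \<open>Multiplying the subordination by f f' removes all quotients, so only products of
    power series remain. Injectivity makes f and f' nonzero away from 0; at 0 both sides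
    vanish.\<close>
  have ev: "\<forall>\<^sub>F z in nhds 0. (1 - a) * (z * (deriv f z * deriv f z))
      + a * (f z * deriv f z + z * (f z * deriv (deriv f) z)) = (\<phi> \<circ> w) z * (f z * deriv f z)"
    using eventually_in_disc
  proof (rule eventually_mono)
    show "(1 - a) * (z * (deriv f z * deriv f z))
      + a * (f z * deriv f z + z * (f z * deriv (deriv f) z)) = (\<phi> \<circ> w) z * (f z * deriv f z)"
      if z: "z \<in> \<D>" for z
    proof (cases "z = 0")
      case False
      have "f z \<noteq> 0"
        using inj_onD[OF inj, of z 0] z f0 False by auto
      moreover have "deriv f z \<noteq> 0"
        using holomorphic_injective_imp_regular[OF hol _ inj z] by simp
      ultimately show ?thesis
        using False by (simp add: eq[OF z, symmetric] log_deriv_def field_simps)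
    qed (simp add: f0)
  qed
  have "(\<lambda>z. (1 - a) * (z * (deriv f z * deriv f z))
      + a * (f z * deriv f z + z * (f z * deriv (deriv f) z))) has_fps_expansion
      fps_const (1 - a) * (fps_X * (fps_deriv F * fps_deriv F))
      + fps_const a * (F * fps_deriv F + fps_X * (F * fps_deriv (fps_deriv F)))" (is "_ has_fps_expansion ?L")
    by (intro fps_expansion_intros F)
  moreover have "(\<lambda>z. (\<phi> \<circ> w) z * (f z * deriv f z)) has_fps_expansion (P oo W) * (F * fps_deriv F)"
    (is "_ has_fps_expansion ?R")
    by (intro fps_expansion_intros F P W) simp
  ultimately have LR: "?L = ?R"
    using ev by (rule has_fps_expansion_eventually_eq)
  have PW1: "(P oo W) $ Suc 0 = P $ 1 * W $ 1"
    and PW2: "(P oo W) $ Suc (Suc 0) = P $ 1 * W $ 2 + P $ 2 * (W $ 1)\<^sup>2"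
    by (simp_all add: fps_compose_nth fps_mult_nth numeral_eq_Suc)
  \<comment> \<open>Since f f' starts with z, the coefficients of z^2 and z^3 here carry the
    information of those of z and z^2 in the subordination.\<close>
  have "?L $ 2 = ?R $ 2" "?L $ 3 = ?R $ 3"
    by (simp_all only: LR)
  then have e2: "(1 + a) * F $ 2 = P $ 1 * W $ 1" 
    and e3: "(1 - a) * (6 * F $ 3 + 4 * (F $ 2)\<^sup>2) + a * (4 * F $ 3 + 2 * (F $ 2)\<^sup>2 + (6 * F $ 3 + 2 * (F $ 2)\<^sup>2))
        = (4 * F $ 3 + 2 * (F $ 2)\<^sup>2) + 3 * F $ 2 * (P $ 1 * W $ 1) + (P $ 1 * W $ 2 + P $ 2 * (W $ 1)\<^sup>2)"
    using PW1 PW2 by (simp_all add: fps_mult_nth numeral_eq_Suc algebra_simps power2_eq_square)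
  \<comment> \<open>The mixed term \<open>3 * F $ 2 * (P $ 1 * W $ 1)\<close> comes from the z^2
    coefficient of f f'; replacing \<open>P $ 1 * W $ 1\<close> by \<open>(1 + a) * F $ 2\<close>
    turns it into a multiple of the square of \<open>F $ 2\<close>.\<close>
  have "2 * (1 + 2 * a) * F $ 3 - (1 + 3 * a) * (F $ 2)\<^sup>2
      = P $ 1 * (W $ 2 + (W $ 1)\<^sup>2) + (P $ 2 - P $ 1) * (W $ 1)\<^sup>2"
    using e3 unfolding e2[symmetric] by (simp add: algebra_simps power2_eq_square)
  then show thesis
    using that[of "W $ 1" "W $ 2 + (W $ 1)\<^sup>2"] Schwarz_function_coeffs[OF w] e2
    unfolding a_def F_def W_def P_def by simp
qed

text \<open>Near 0 the composition of f after g is the identity, so its coefficients of z^2 and z^3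
  vanish; these two equations are solved for the coefficients of \<open>g\<close>.\<close>

lemma univalent_inverse_coeffs:
  assumes f: "f \<in> class_S" and g: "g \<in> class_S" and inv: "univalent_inverse f g"
  shows "taylor_coeff g 2 = - taylor_coeff f 2"
    and "taylor_coeff g 3 = 2 * (taylor_coeff f 2)\<^sup>2 - taylor_coeff f 3"
proof -
  define F where "F = fps_expansion f 0"
  define G where "G = fps_expansion g 0"
  have F: "f has_fps_expansion F" and [simp]: "F $ 0 = 0" "F $ Suc 0 = 1"
    using class_S_taylor_coeff[OF f] by (simp_all add: F_def)
  have G: "g has_fps_expansion G" and [simp]: "G $ 0 = 0" "G $ Suc 0 = 1"
    using class_S_taylor_coeff[OF g] by (simp_all add: G_def)
  \<comment> \<open>The choice made by \<open>inv_into\<close> is a right inverse of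
    \<open>f\<close> only on the image of the disc, which is a neighbourhood of 0 by the open
    mapping theorem.\<close>
  have "open (f ` \<D>)" "0 \<in> f ` \<D>"
    using f open_mapping_thm3[of f \<D>] by (force simp: class_S_def univalent_def)+
  then have "\<forall>\<^sub>F z in nhds 0. z \<in> f ` \<D>"
    by (rule eventually_nhds_in_open)
  moreover have "\<forall>\<^sub>F z in nhds 0. g z = inv_into \<D> f z"
    using inv by (simp add: univalent_inverse_def)
  ultimately have "\<forall>\<^sub>F z in nhds 0. (f \<circ> g) z = z"
    by eventually_elim (simp add: f_inv_into_f)
  moreover have "(f \<circ> g) has_fps_expansion (F oo G)"
    by (intro fps_expansion_intros F G) simp
  ultimately have "F oo G = fps_X"
    using has_fps_expansion_eventually_eq has_fps_expansion_fps_X by blast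
  then have "(F oo G) $ 2 = 0" "(F oo G) $ 3 = 0"
    by (simp_all add: fps_X_def)
  then have "G $ 2 + F $ 2 = 0" and e3: "G $ 3 + 2 * F $ 2 * G $ 2 + F $ 3 = 0"
    by (simp_all add: fps_compose_nth fps_mult_nth numeral_eq_Suc algebra_simps)
  then have "G $ 2 = - F $ 2" 
    by (simp add: eq_neg_iff_add_eq_0)
  moreover from e3 have "G $ 3 = 2 * (F $ 2)\<^sup>2 - F $ 3"
    unfolding calculation by (simp add: algebra_simps power2_eq_square eq_diff_eq add_eq_0_iff)
  ultimately show "taylor_coeff g 2 = - taylor_coeff f 2"
    and "taylor_coeff g 3 = 2 * (taylor_coeff f 2)\<^sup>2 - taylor_coeff f 3"
    by (simp_all add: F_def G_def)
qed

section \<open>The two coefficient bounds\<close>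

theorem theorem2p4:
  fixes \<alpha> \<beta> B\<^sub>1 B\<^sub>2 D\<^sub>1 D\<^sub>2 \<sigma> :: real
    and \<phi> \<psi> f g :: "complex \<Rightarrow> complex"
  assumes "\<alpha> \<ge> 0" and "\<beta> \<ge> 0"
    and "\<phi> holomorphic_on \<D>" and "\<phi> 0 = 1"
    and "taylor_coeff \<phi> 1 = of_real B\<^sub>1" and "taylor_coeff \<phi> 2 = of_real B\<^sub>2"
    and "B\<^sub>1 > 0"
    and "\<psi> holomorphic_on \<D>" and "\<psi> 0 = 1"
    and "taylor_coeff \<psi> 1 = of_real D\<^sub>1" and "taylor_coeff \<psi> 2 = of_real D\<^sub>2"
    and "D\<^sub>1 > 0"
    and "bi_univalent f" and "univalent_inverse f g"
    and "f \<in> class_M \<alpha> \<phi>" and "g \<in> class_M \<beta> \<psi>"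
    and "\<sigma> = 2 + 3 * \<alpha> + 3 * \<beta> + 4 * \<alpha> * \<beta>"
  shows
    "(sqrt \<bar>\<sigma> * B\<^sub>1^2 * D\<^sub>1^2
            - (1 + \<alpha>)^2 * (1 + 2 * \<beta>) * (B\<^sub>2 - B\<^sub>1) * D\<^sub>1^2
            - (1 + \<beta>)^2 * (1 + 2 * \<alpha>) * (D\<^sub>2 - D\<^sub>1) * B\<^sub>1^2\<bar> \<noteq> 0 \<longrightarrow>
      cmod (taylor_coeff f 2) \<le>
        B\<^sub>1 * D\<^sub>1 * sqrt (B\<^sub>1 * (1 + 2 * \<beta>) + D\<^sub>1 * (1 + 2 * \<alpha>))
        / sqrt \<bar>\<sigma> * B\<^sub>1^2 * D\<^sub>1^2
                - (1 + \<alpha>)^2 * (1 + 2 * \<beta>) * (B\<^sub>2 - B\<^sub>1) * D\<^sub>1^2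
                - (1 + \<beta>)^2 * (1 + 2 * \<alpha>) * (D\<^sub>2 - D\<^sub>1) * B\<^sub>1^2\<bar>) \<and>
     2 * \<sigma> * cmod (taylor_coeff f 3) \<le>
       B\<^sub>1 * (3 + 5 * \<beta>) + D\<^sub>1 * (1 + 3 * \<alpha>) + (3 + 5 * \<beta>) * \<bar>B\<^sub>2 - B\<^sub>1\<bar>
       + (1 + \<beta>)^2 * (1 + 3 * \<alpha>) * B\<^sub>1^2 * \<bar>D\<^sub>2 - D\<^sub>1\<bar> / (D\<^sub>1^2 * (1 + \<alpha>)^2)"
proof -
  define A2 A3 where "A2 = taylor_coeff f 2" and "A3 = taylor_coeff f 3"
  define a b where "a = complex_of_real \<alpha>" and "b = complex_of_real \<beta>"
  have pos: "1 + \<alpha> > 0" "1 + 2 * \<alpha> > 0" "1 + 3 * \<alpha> > 0" "1 + 2 * \<beta> > 0" "3 + 5 * \<beta> > 0"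
    using assms by auto
  have "f \<in> class_S" "g \<in> class_S"
    using assms by (auto simp: class_M_def)
  note g_coeffs = univalent_inverse_coeffs[OF this \<open>univalent_inverse f g\<close>]
  obtain c p :: complex where c: "norm c \<le> 1" and p: "norm p \<le> 1"
    and ec: "(1 + a) * A2 = B\<^sub>1 * c"
    and ep: "2 * (1 + 2 * a) * A3 - (1 + 3 * a) * A2\<^sup>2 = B\<^sub>1 * p + (B\<^sub>2 - B\<^sub>1) * c\<^sup>2"
    using class_M_coeffs[OF assms(15,3,4)] unfolding assms(5,6) a_def A2_def A3_def by auto
  \<comment> \<open>The equations for \<open>g\<close> are rewritten at once in the coefficients of
    \<open>f\<close>; the minus sign in the first one comes from the second coefficient of the
    inverse.\<close>
  obtain d q :: complex where "norm d \<le> 1" and q: "norm q \<le> 1"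
    and ed: "- ((1 + b) * A2) = D\<^sub>1 * d"
    and eq: "2 * (1 + 2 * b) * (2 * A2\<^sup>2 - A3) - (1 + 3 * b) * A2\<^sup>2 = D\<^sub>1 * q + (D\<^sub>2 - D\<^sub>1) * d\<^sup>2"
    using class_M_coeffs[OF assms(16,8,9)] unfolding assms(10,11) b_def A2_def A3_def g_coeffs by auto
  have c2: "B\<^sub>1\<^sup>2 * c\<^sup>2 = (1 + a)\<^sup>2 * A2\<^sup>2"
    using ec by (metis of_real_power power_mult_distrib)
  have d2: "D\<^sub>1\<^sup>2 * d\<^sup>2 = (1 + b)\<^sup>2 * A2\<^sup>2"
    using ed by (metis of_real_power power_mult_distrib power2_minus)
  \<comment> \<open>This is the coefficient of \<open>A2\<^sup>2\<close> once the terms in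
    \<open>c\<^sup>2\<close> and \<open>d\<^sup>2\<close> have been expressed by
    \<open>A2\<^sup>2\<close> and moved to the left; the factor
    \<open>B\<^sub>1\<^sup>2 * D\<^sub>1\<^sup>2\<close> clears the denominators of that
    substitution.\<close>
  define \<Delta> where "\<Delta> = \<sigma> * B\<^sub>1^2 * D\<^sub>1^2
            - (1 + \<alpha>)^2 * (1 + 2 * \<beta>) * (B\<^sub>2 - B\<^sub>1) * D\<^sub>1^2
            - (1 + \<beta>)^2 * (1 + 2 * \<alpha>) * (D\<^sub>2 - D\<^sub>1) * B\<^sub>1^2"
  have \<sigma>: "complex_of_real \<sigma> = 2 + 3 * a + 3 * b + 4 * a * b"
    by (simp add: assms(17) a_def b_def)

  \<comment> \<open>Bound for the second coefficient\<close>
  \<comment> \<open>The weights 1 + 2b and 1 + 2a make the two \<open>A3\<close> terms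
    cancel.\<close>
  have "\<sigma> * A2\<^sup>2 = (1 + 2 * b) * (2 * (1 + 2 * a) * A3 - (1 + 3 * a) * A2\<^sup>2)
      + (1 + 2 * a) * (2 * (1 + 2 * b) * (2 * A2\<^sup>2 - A3) - (1 + 3 * b) * A2\<^sup>2)"
    unfolding \<sigma> by (simp add: algebra_simps)
  also have "\<dots> = (1 + 2 * b) * (B\<^sub>1 * p + (B\<^sub>2 - B\<^sub>1) * c\<^sup>2) + (1 + 2 * a) * (D\<^sub>1 * q + (D\<^sub>2 - D\<^sub>1) * d\<^sup>2)"
    by (simp only: ep eq)
  finally have "B\<^sub>1\<^sup>2 * D\<^sub>1\<^sup>2 * (\<sigma> * A2\<^sup>2) = B\<^sub>1\<^sup>2 * D\<^sub>1\<^sup>2 * \<dots>"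
    by simp
  also have "\<dots> = B\<^sub>1\<^sup>2 * D\<^sub>1\<^sup>2 * ((1 + 2 * b) * B\<^sub>1 * p + (1 + 2 * a) * D\<^sub>1 * q)
      + (1 + 2 * b) * (B\<^sub>2 - B\<^sub>1) * D\<^sub>1\<^sup>2 * (B\<^sub>1\<^sup>2 * c\<^sup>2) + (1 + 2 * a) * (D\<^sub>2 - D\<^sub>1) * B\<^sub>1\<^sup>2 * (D\<^sub>1\<^sup>2 * d\<^sup>2)"
    by (simp add: algebra_simps)
  finally have key2: "\<Delta> * A2\<^sup>2 = B\<^sub>1\<^sup>2 * D\<^sub>1\<^sup>2 * ((1 + 2 * b) * B\<^sub>1 * p + (1 + 2 * a) * D\<^sub>1 * q)"
    unfolding c2 d2 \<Delta>_def by (simp add: a_def b_def algebra_simps)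
  have "norm ((1 + 2 * b) * B\<^sub>1 * p + (1 + 2 * a) * D\<^sub>1 * q)
      \<le> norm (of_real ((1 + 2 * \<beta>) * B\<^sub>1) * p) + norm (of_real ((1 + 2 * \<alpha>) * D\<^sub>1) * q)"
    using norm_triangle_ineq by (simp add: a_def b_def)
  also have "\<dots> = (1 + 2 * \<beta>) * B\<^sub>1 * norm p + (1 + 2 * \<alpha>) * D\<^sub>1 * norm q"
    using pos assms(7,12) by (simp only: norm_mult norm_of_real abs_mult abs_of_pos)
  also have "\<dots> \<le> (1 + 2 * \<beta>) * B\<^sub>1 * 1 + (1 + 2 * \<alpha>) * D\<^sub>1 * 1"
    using pos assms(7,12) p q by (intro add_mono mult_left_mono) auto
  finally have S: "norm ((1 + 2 * b) * B\<^sub>1 * p + (1 + 2 * a) * D\<^sub>1 * q)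
      \<le> B\<^sub>1 * (1 + 2 * \<beta>) + D\<^sub>1 * (1 + 2 * \<alpha>)"
    by (simp add: mult.commute)
  have "\<bar>\<Delta>\<bar> * (norm A2)\<^sup>2 = norm (\<Delta> * A2\<^sup>2)"
    by (simp add: norm_mult norm_power)
  also have "\<dots> = (B\<^sub>1 * D\<^sub>1)\<^sup>2 * norm ((1 + 2 * b) * B\<^sub>1 * p + (1 + 2 * a) * D\<^sub>1 * q)"
    unfolding key2 by (simp add: norm_mult norm_power power_mult_distrib)
  also have "\<dots> \<le> (B\<^sub>1 * D\<^sub>1)\<^sup>2 * (B\<^sub>1 * (1 + 2 * \<beta>) + D\<^sub>1 * (1 + 2 * \<alpha>))"
    using S by (intro mult_left_mono) auto
  finally have "sqrt (\<bar>\<Delta>\<bar> * (norm A2)\<^sup>2) \<le> sqrt ((B\<^sub>1 * D\<^sub>1)\<^sup>2 * (B\<^sub>1 * (1 + 2 * \<beta>) + D\<^sub>1 * (1 + 2 * \<alpha>)))"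
    by (rule real_sqrt_le_mono)
  then have "sqrt \<bar>\<Delta>\<bar> * norm A2 \<le> B\<^sub>1 * D\<^sub>1 * sqrt (B\<^sub>1 * (1 + 2 * \<beta>) + D\<^sub>1 * (1 + 2 * \<alpha>))"
    using assms(7,12) by (simp add: real_sqrt_mult)
  then have bound2: "norm A2 \<le> B\<^sub>1 * D\<^sub>1 * sqrt (B\<^sub>1 * (1 + 2 * \<beta>) + D\<^sub>1 * (1 + 2 * \<alpha>)) / sqrt \<bar>\<Delta>\<bar>"
    if "sqrt \<bar>\<Delta>\<bar> \<noteq> 0"
    using that by (simp add: pos_le_divide_eq mult.commute)

  \<comment> \<open>Bound for the third coefficient\<close>
  define K where "K = (1 + \<beta>)\<^sup>2 * (1 + 3 * \<alpha>) * B\<^sub>1\<^sup>2 * \<bar>D\<^sub>2 - D\<^sub>1\<bar> / (D\<^sub>1\<^sup>2 * (1 + \<alpha>)\<^sup>2)"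
  have nc: "(norm c)\<^sup>2 \<le> 1"
    using c by (simp add: abs_square_le_1)
  \<comment> \<open>Both \<open>c\<close> and \<open>d\<close> are multiples of \<open>A2\<close>,
    so |d| is a fixed multiple of |c|, and |c| \<le> 1 bounds it. This ratio is the source of the
    quotient in \<open>K\<close>.\<close>
  have "(D\<^sub>1\<^sup>2 * (1 + \<alpha>)\<^sup>2) * (norm d)\<^sup>2 = (1 + \<alpha>)\<^sup>2 * norm (D\<^sub>1\<^sup>2 * d\<^sup>2)"
    by (simp add: norm_mult norm_power)
  also have "\<dots> = (1 + \<beta>)\<^sup>2 * norm ((1 + a)\<^sup>2 * A2\<^sup>2)"
  proof -
    have "norm (1 + a) = 1 + \<alpha>" "norm (1 + b) = 1 + \<beta>"
      using assms(1,2) norm_of_real[of "1 + \<alpha>"] norm_of_real[of "1 + \<beta>"] by (auto simp: a_def b_def)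
    then show ?thesis
      unfolding d2 by (simp add: norm_mult norm_power)
  qed
  also have "\<dots> = (1 + \<beta>)\<^sup>2 * B\<^sub>1\<^sup>2 * (norm c)\<^sup>2"
    unfolding c2[symmetric] by (simp add: norm_mult norm_power)
  also have "\<dots> \<le> (1 + \<beta>)\<^sup>2 * B\<^sub>1\<^sup>2 * 1"
    using nc by (intro mult_left_mono) auto
  finally have "(norm d)\<^sup>2 \<le> (1 + \<beta>)\<^sup>2 * B\<^sub>1\<^sup>2 / (D\<^sub>1\<^sup>2 * (1 + \<alpha>)\<^sup>2)"
    using pos assms(12) by (simp add: pos_le_divide_eq mult.commute)
  then have "(1 + 3 * \<alpha>) * \<bar>D\<^sub>2 - D\<^sub>1\<bar> * (norm d)\<^sup>2
      \<le> (1 + 3 * \<alpha>) * \<bar>D\<^sub>2 - D\<^sub>1\<bar> * ((1 + \<beta>)\<^sup>2 * B\<^sub>1\<^sup>2 / (D\<^sub>1\<^sup>2 * (1 + \<alpha>)\<^sup>2))"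
    using pos by (intro mult_left_mono) auto
  also have "\<dots> = K"
    by (simp add: K_def)
  finally have nd: "(1 + 3 * \<alpha>) * \<bar>D\<^sub>2 - D\<^sub>1\<bar> * (norm d)\<^sup>2 \<le> K" .

  \<comment> \<open>In the equation for \<open>g\<close> the factor of \<open>A2\<^sup>2\<close> is
    4(1 + 2b) - (1 + 3b) = 3 + 5b, in the one for \<open>f\<close> it is -(1 + 3a);
    cross-multiplying eliminates \<open>A2\<^sup>2\<close>.\<close>
  have "2 * \<sigma> * A3 = (3 + 5 * b) * (2 * (1 + 2 * a) * A3 - (1 + 3 * a) * A2\<^sup>2)
      + (1 + 3 * a) * (2 * (1 + 2 * b) * (2 * A2\<^sup>2 - A3) - (1 + 3 * b) * A2\<^sup>2)"
    by (simp add: \<sigma> algebra_simps)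
  also have "\<dots> = of_real (3 + 5 * \<beta>) * (B\<^sub>1 * p + of_real (B\<^sub>2 - B\<^sub>1) * c\<^sup>2)
      + of_real (1 + 3 * \<alpha>) * (D\<^sub>1 * q + of_real (D\<^sub>2 - D\<^sub>1) * d\<^sup>2)"
    unfolding ep eq by (simp add: a_def b_def)
  finally have key3: "2 * \<sigma> * A3 = \<dots>" .
  have "\<sigma> > 0"
    using assms(1,2) by (auto simp: assms(17) intro!: add_pos_nonneg)
  then have "2 * \<sigma> * norm A3 = norm (2 * \<sigma> * A3)"
    by (simp add: norm_mult)
  also have "\<dots> \<le> norm (of_real (3 + 5 * \<beta>) * (B\<^sub>1 * p + of_real (B\<^sub>2 - B\<^sub>1) * c\<^sup>2))
      + norm (of_real (1 + 3 * \<alpha>) * (D\<^sub>1 * q + of_real (D\<^sub>2 - D\<^sub>1) * d\<^sup>2))"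
    unfolding key3 by (rule norm_triangle_ineq)
  also have "\<dots> = (3 + 5 * \<beta>) * norm (B\<^sub>1 * p + of_real (B\<^sub>2 - B\<^sub>1) * c\<^sup>2)
      + (1 + 3 * \<alpha>) * norm (D\<^sub>1 * q + of_real (D\<^sub>2 - D\<^sub>1) * d\<^sup>2)"
    using pos by (simp only: norm_mult norm_of_real abs_of_pos)
  \<comment> \<open>Here |c| is replaced by 1 but |d| is kept, because its term is estimated through
    |c| by \<open>K\<close>; hence the asymmetry between the two last terms of the bound.\<close>
  also have "\<dots> \<le> (3 + 5 * \<beta>) * (B\<^sub>1 * 1 + \<bar>B\<^sub>2 - B\<^sub>1\<bar> * 1)
      + (1 + 3 * \<alpha>) * (D\<^sub>1 * 1 + \<bar>D\<^sub>2 - D\<^sub>1\<bar> * (norm d)\<^sup>2)"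
  proof -
    have "norm (B\<^sub>1 * p + of_real (B\<^sub>2 - B\<^sub>1) * c\<^sup>2) \<le> B\<^sub>1 * norm p + \<bar>B\<^sub>2 - B\<^sub>1\<bar> * (norm c)\<^sup>2"
      using norm_triangle_ineq[of "B\<^sub>1 * p" "of_real (B\<^sub>2 - B\<^sub>1) * c\<^sup>2"] assms(7)
      by (simp only: norm_mult norm_of_real norm_power abs_of_pos)
    also have "\<dots> \<le> B\<^sub>1 * 1 + \<bar>B\<^sub>2 - B\<^sub>1\<bar> * 1"
      using assms(7) p nc by (intro add_mono mult_left_mono) auto
    finally have 1: "norm (B\<^sub>1 * p + of_real (B\<^sub>2 - B\<^sub>1) * c\<^sup>2) \<le> B\<^sub>1 * 1 + \<bar>B\<^sub>2 - B\<^sub>1\<bar> * 1" .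
    have "norm (D\<^sub>1 * q + of_real (D\<^sub>2 - D\<^sub>1) * d\<^sup>2) \<le> D\<^sub>1 * norm q + \<bar>D\<^sub>2 - D\<^sub>1\<bar> * (norm d)\<^sup>2"
      using norm_triangle_ineq[of "D\<^sub>1 * q" "of_real (D\<^sub>2 - D\<^sub>1) * d\<^sup>2"] assms(12)
      by (simp only: norm_mult norm_of_real norm_power abs_of_pos)
    also have "\<dots> \<le> D\<^sub>1 * 1 + \<bar>D\<^sub>2 - D\<^sub>1\<bar> * (norm d)\<^sup>2"
      using assms(12) q by (intro add_mono mult_left_mono) auto
    finally show ?thesis
      using 1 pos by (intro add_mono mult_left_mono) auto
  qed
  also have "\<dots> \<le> B\<^sub>1 * (3 + 5 * \<beta>) + D\<^sub>1 * (1 + 3 * \<alpha>) + (3 + 5 * \<beta>) * \<bar>B\<^sub>2 - B\<^sub>1\<bar> + K"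
    using nd by (simp add: algebra_simps)
  finally show ?thesis
    using bound2 unfolding A2_def A3_def \<Delta>_def K_def by blast
qed

end
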